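(* Let $X,Y,Z$ be abelian groups and $d,e\ge0$ integers. If $g: X \to Y$ is polynomial of degree $\leq d$ and $f: Y \to Z$ is polynomial of degree $\leq e$, then $f \circ g$ is polynomial of degree $\leq ed$.
   Context: For a map $h:A\to B$ between abelian groups, $a\in A$, $w_1,\dots,w_k\in A$, the iterated forward difference is $\Delta(h;a;w_1,\dots,w_k)=\sum_{S\subseteq\{1,\dots,k\}}(-1)^{k-|S|}h(a+\sum_{i\in S}w_i)$. The map $h$ is polynomial of degree $\le d$ if $\Delta^{d+1}h\equiv0$, i.e. $\Delta(h;a;w_1,\dots,w_{d+1})=0$ for all $a,w_1,\dots,w_{d+1}\in A$. *)

theory Defs
  imports Main
begin

text \<open>Abelian groups are types of class \<^class>\<open>ab_group_add\<close>. The steps \<open>w\<^sub>1, \<dots>, w\<^sub>k\<close> are the values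
  at \<open>1, \<dots>, k\<close> of a function on the naturals; its other values do not matter. The codomain
  carries no multiplication, so the sign \<open>(-1)\<^sup>k\<^sup>-\<^sup>|\<^sup>S\<^sup>|\<close> becomes a case distinction on parity;
  the subtraction of naturals is exact because \<open>S \<subseteq> {1..k}\<close>.\<close>

definition iterated_diff ::
    "('a::ab_group_add \<Rightarrow> 'b::ab_group_add) \<Rightarrow> 'a \<Rightarrow> nat \<Rightarrow> (nat \<Rightarrow> 'a) \<Rightarrow> 'b" where
  "iterated_diff h a k w =
     (\<Sum>S\<in>Pow {1..k}.
        if even (k - card S) then h (a + (\<Sum>i\<in>S. w i)) else - h (a + (\<Sum>i\<in>S. w i)))"

definition polynomial_of_degree_le ::
    "('a::ab_group_add \<Rightarrow> 'b::ab_group_add) \<Rightarrow> nat \<Rightarrow> bool" where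
  "polynomial_of_degree_le h d \<longleftrightarrow> (\<forall>a w. iterated_diff h a (d + 1) w = 0)"

end

theory Submission
  imports Defs
begin

text \<open>Iterated differences and values on the vertices of a cube determine each other by Moebius
  inversion on the Boolean lattice. Write \<open>g\<^sub>T\<close> for the difference of \<open>g\<close> at \<open>a\<close> with the
  steps \<open>w\<^sub>i\<close>, \<open>i \<in> T\<close>. Inversion for \<open>g\<close>, and then for \<open>f\<close> with base point \<open>0\<close> and
  the elements \<open>g\<^sub>T\<close> as steps, gives (both times by \<open>value_eq_sum_cube_diff\<close>)

    \<open>f (g (a + (\<Sum>i\<in>S. w\<^sub>i))) = f (\<Sum>T\<in>Pow S. g\<^sub>T) = (\<Sum>J\<in>Pow (Pow S). c\<^sub>J)\<close>,

  where \<open>c\<^sub>J\<close> is the difference of \<open>f\<close> at \<open>0\<close> with the steps \<open>g\<^sub>T\<close>, \<open>T \<in> J\<close>, and so does not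
  depend on \<open>S\<close>. In the alternating sum over \<open>S \<subseteq> I\<close> the term \<open>c\<^sub>J\<close> occurs exactly for the
  \<open>S\<close> that contain \<open>\<Union>J\<close>, with signs that cancel unless \<open>\<Union>J = I\<close>
  (\<open>sum_signed_card_interval\<close>). On the other hand \<open>c\<^sub>J\<close> is nonzero only if \<open>J\<close> has at most
  \<open>e\<close> members, by the degree of \<open>f\<close>, and each member has at most \<open>d\<close> elements, since otherwise
  the degree of \<open>g\<close> makes some step \<open>g\<^sub>T\<close> zero. Such a family covers at most \<open>e * d\<close> indices,
  so it cannot cover an index set \<open>I\<close> with \<open>e * d + 1\<close> elements, and everything cancels.\<close>

definition signed :: "nat \<Rightarrow> 'a::ab_group_add \<Rightarrow> 'a" where
  "signed n x = (if even n then x else - x)"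

text \<open>The indices may have any type, because the proof takes differences of \<open>f\<close> whose steps are
  indexed by sets of the original indices.\<close>

definition cube_diff ::
    "('a::ab_group_add \<Rightarrow> 'b::ab_group_add) \<Rightarrow> 'a \<Rightarrow> 'i set \<Rightarrow> ('i \<Rightarrow> 'a) \<Rightarrow> 'b" where
  "cube_diff h a I w = (\<Sum>S\<in>Pow I. signed (card I - card S) (h (a + sum w S)))"

lemma signed_zero [simp]: "signed n 0 = 0"
  by (simp add: signed_def)

lemma signed_sum: "signed n (sum h A) = (\<Sum>x\<in>A. signed n (h x))"
  by (simp add: signed_def sum_negf)

lemma signed_Suc: "signed (Suc n) x = - signed n x"
  by (simp add: signed_def)

lemma signed_diff: "n \<le> m \<Longrightarrow> signed (m - n) x = signed n (signed m x)"
  by (simp add: signed_def)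

lemma sum_Pow_insert:
  fixes h :: "'i set \<Rightarrow> 'a::comm_monoid_add"
  assumes "finite I" "i \<notin> I"
  shows "(\<Sum>S\<in>Pow (insert i I). h S) = (\<Sum>S\<in>Pow I. h S) + (\<Sum>S\<in>Pow I. h (insert i S))"
proof -
  have "inj_on (insert i) (Pow I)"
    using assms(2) by (auto simp: inj_on_def)
  moreover have "Pow I \<inter> insert i ` Pow I = {}"
    using assms(2) by auto
  ultimately show ?thesis
    using assms(1) by (simp add: Pow_insert sum.union_disjoint sum.reindex)
qed

text \<open>For an index \<open>i \<in> I - T\<close>, the sets \<open>S\<close> and \<open>S \<union> {i}\<close> with \<open>i \<notin> S\<close> cancel.\<close>

lemma sum_signed_card_interval:
  fixes x :: "'a::ab_group_add"
  assumes "finite I" "T \<subset> I"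
  shows "(\<Sum>S\<in>{S\<in>Pow I. T \<subseteq> S}. signed (card S) x) = 0"
proof -
  obtain i where i: "i \<in> I" "i \<notin> T"
    using assms(2) by auto
  define I' where "I' = I - {i}"
  have I: "I = insert i I'" "i \<notin> I'" "finite I'"
    using i assms(1) by (auto simp: I'_def)
  have "(\<Sum>S\<in>{S\<in>Pow I. T \<subseteq> S}. signed (card S) x)
      = (\<Sum>S\<in>Pow I. if T \<subseteq> S then signed (card S) x else 0)"
    using assms(1) by (intro sum.inter_filter) simp
  also have "\<dots> = (\<Sum>S\<in>Pow I'. if T \<subseteq> S then signed (card S) x else 0)
      + (\<Sum>S\<in>Pow I'. if T \<subseteq> insert i S then signed (card (insert i S)) x else 0)"
    unfolding I(1) using I by (intro sum_Pow_insert)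
  also have "(\<Sum>S\<in>Pow I'. if T \<subseteq> insert i S then signed (card (insert i S)) x else 0)
      = (\<Sum>S\<in>Pow I'. - (if T \<subseteq> S then signed (card S) x else 0))"
  proof (rule sum.cong[OF refl])
    fix S assume "S \<in> Pow I'"
    then have "finite S" "i \<notin> S"
      using I finite_subset by auto
    then show "(if T \<subseteq> insert i S then signed (card (insert i S)) x else 0)
        = - (if T \<subseteq> S then signed (card S) x else 0)"
      using i(2) by (auto simp: signed_Suc)
  qed
  finally show ?thesis
    by (simp add: sum_negf)
qed

text \<open>Inserting the definition of the differences and exchanging the sums, the value at the vertex
  \<open>S\<close> is weighted by the alternating sum over all \<open>J\<close> between \<open>S\<close> and \<open>I\<close>, so that only the
  vertex \<open>S = I\<close> survives.\<close>

lemma value_eq_sum_cube_diff: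
  fixes h :: "'a::ab_group_add \<Rightarrow> 'b::ab_group_add"
  assumes "finite I"
  shows "h (a + sum w I) = (\<Sum>J\<in>Pow I. cube_diff h a J w)"
proof -
  define v where "v S = h (a + sum w S)" for S
  have "(\<Sum>J\<in>Pow I. cube_diff h a J w)
      = (\<Sum>J\<in>Pow I. \<Sum>S\<in>{S\<in>Pow I. S \<subseteq> J}. signed (card J) (signed (card S) (v S)))"
    unfolding cube_diff_def v_def
  proof (intro sum.cong refl)
    fix J S assume J: "J \<in> Pow I" and S: "S \<in> {S \<in> Pow I. S \<subseteq> J}"
    then have "card S \<le> card J"
      using assms by (auto intro: card_mono finite_subset)
    then show "signed (card J - card S) (h (a + sum w S))
        = signed (card J) (signed (card S) (h (a + sum w S)))"
      by (simp add: signed_def)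
  qed auto
  also have "\<dots> = (\<Sum>S\<in>Pow I. \<Sum>J\<in>{J\<in>Pow I. S \<subseteq> J}. signed (card J) (signed (card S) (v S)))"
    using assms by (intro sum.swap_restrict) auto
  also have "\<dots> = (\<Sum>S\<in>Pow I. if S = I then v I else 0)"
  proof (intro sum.cong refl)
    fix S assume S: "S \<in> Pow I"
    show "(\<Sum>J\<in>{J\<in>Pow I. S \<subseteq> J}. signed (card J) (signed (card S) (v S)))
        = (if S = I then v I else 0)"
    proof (cases "S = I")
      case True
      then have "{J\<in>Pow I. S \<subseteq> J} = {I}"
        by auto
      then show ?thesis
        using True by (simp add: signed_def)
    next
      case False
      then show ?thesis
        using S assms by (intro trans[OF sum_signed_card_interval]) auto
    qed
  qed
  also have "\<dots> = v I"
    using assms by simp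
  finally show ?thesis
    by (simp add: v_def)
qed

lemma cube_diff_insert:
  fixes h :: "'a::ab_group_add \<Rightarrow> 'b::ab_group_add"
  assumes "finite I" "i \<notin> I"
  shows "cube_diff h a (insert i I) w = cube_diff h (a + w i) I w - cube_diff h a I w"
proof -
  have fin: "finite S" "i \<notin> S" "card S \<le> card I" if "S \<in> Pow I" for S
    using that assms by (auto intro: card_mono finite_subset)
  have "(\<Sum>S\<in>Pow I. signed (card (insert i I) - card S) (h (a + sum w S)))
      = (\<Sum>S\<in>Pow I. - signed (card I - card S) (h (a + sum w S)))"
    using fin assms by (intro sum.cong refl) (simp add: Suc_diff_le signed_Suc)
  moreover have "(\<Sum>S\<in>Pow I. signed (card (insert i I) - card (insert i S)) (h (a + sum w (insert i S))))
      = (\<Sum>S\<in>Pow I. signed (card I - card S) (h (a + w i + sum w S)))"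
    using fin assms by (intro sum.cong refl) (simp add: add.assoc)
  ultimately show ?thesis
    unfolding cube_diff_def sum_Pow_insert[OF assms] by (simp add: sum_negf)
qed

text \<open>Differencing along the zero step last subtracts a map from itself.\<close>

lemma cube_diff_zero_step:
  assumes "finite I" "i \<in> I" "w i = 0"
  shows "cube_diff h a I w = 0"
  using cube_diff_insert[of "I - {i}" i h a w] assms by (simp add: insert_absorb)

lemma cube_diff_reindex:
  fixes h :: "'a::ab_group_add \<Rightarrow> 'b::ab_group_add"
  assumes "inj_on b I"
  shows "cube_diff h a (b ` I) w = cube_diff h a I (w \<circ> b)"
proof -
  have "inj_on ((`) b) (Pow I)"
    using assms by (simp add: inj_on_image_Pow)
  moreover have "inj_on b S" if "S \<in> Pow I" for S
    using that assms inj_on_subset by blast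
  ultimately show ?thesis
    using assms unfolding cube_diff_def image_Pow_surj[OF refl, symmetric]
    by (simp add: sum.reindex card_image)
qed

lemma iterated_diff_eq_cube_diff: "iterated_diff h a k w = cube_diff h a {1..k} w"
  by (simp add: iterated_diff_def cube_diff_def signed_def)

text \<open>The definition speaks of exactly \<open>d + 1\<close> steps; a difference with more steps is a
  difference of differences with fewer.\<close>

lemma cube_diff_eq_0_of_degree:
  assumes "polynomial_of_degree_le h d" "finite I" "d < card I"
  shows "cube_diff h a I w = 0"
proof -
  obtain K where K: "K \<subseteq> I" "card K = d + 1"
    using assms(3) obtain_subset_with_card_n[of "d + 1" I] by auto
  have "finite K"
    using K assms(2) finite_subset by auto
  then obtain b where "bij_betw b {1..d + 1} K"
    using ex_bij_betw_nat_finite_1[of K] K(2) by auto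
  then have base: "cube_diff h c K w = 0" for c
    using assms(1) cube_diff_reindex[of b "{1..d + 1}" h c w]
    by (simp add: bij_betw_def polynomial_of_degree_le_def iterated_diff_eq_cube_diff)
  have "finite L \<Longrightarrow> K \<inter> L = {} \<Longrightarrow> cube_diff h c (K \<union> L) w = 0" for L c
  proof (induction L arbitrary: c rule: finite_induct)
    case (insert i L)
    then show ?case
      using \<open>finite K\<close> by (simp add: cube_diff_insert)
  qed (simp add: base)
  from this[of "I - K" a] show ?thesis
    using K(1) assms(2) by (simp add: Un_absorb1 Un_Diff_cancel)
qed

theorem corollary42:
  fixes g :: "'x::ab_group_add \<Rightarrow> 'y::ab_group_add"
    and f :: "'y \<Rightarrow> 'z::ab_group_add"
    and d e :: nat
  assumes "polynomial_of_degree_le g d"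
    and "polynomial_of_degree_le f e"
  shows "polynomial_of_degree_le (f \<circ> g) (e * d)"
  unfolding polynomial_of_degree_le_def
proof (intro allI)
  fix a :: 'x and w :: "nat \<Rightarrow> 'x"
  define I where "I = {1..e * d + 1}"
  define c where "c J = cube_diff f 0 J (\<lambda>T. cube_diff g a T w)" for J
  have I: "finite I" "card I = e * d + 1"
    by (simp_all add: I_def)
  have expand: "f (g (a + sum w S)) = (\<Sum>J\<in>Pow (Pow S). c J)" if "S \<in> Pow I" for S
  proof -
    have "finite S"
      using that I finite_subset by auto
    then show ?thesis
      using value_eq_sum_cube_diff[of "Pow S" f 0 "\<lambda>T. cube_diff g a T w"]
      by (simp add: c_def value_eq_sum_cube_diff[of S g])
  qed
  \<comment> \<open>A family that covers \<open>I\<close> has more than \<open>e\<close> members or a member with more than \<open>d\<close> elements.\<close>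
  have c_zero: "c J = 0" if J: "J \<subseteq> Pow I" "\<Union>J = I" for J
  proof -
    have "finite J"
      using J(1) I(1) by (auto intro: finite_subset)
    show ?thesis
    proof (cases "card J \<le> e \<and> (\<forall>T\<in>J. card T \<le> d)")
      case True
      have "card (\<Union>J) \<le> (\<Sum>T\<in>J. card T)"
        using \<open>finite J\<close> card_UN_le[of J "\<lambda>T. T"] by simp
      also have "\<dots> \<le> card J * d"
        using True sum_bounded_above[of J card d] by simp
      also have "\<dots> \<le> e * d"
        using True by simp
      finally show ?thesis
        using I(2) J(2) by simp
    next
      case False
      then consider "e < card J" | T where "T \<in> J" "d < card T"
        by force
      then show ?thesis
      proof cases
        case 1
        then show ?thesis
          using \<open>finite J\<close> assms(2) by (simp add: c_def cube_diff_eq_0_of_degree)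
      next
        case 2
        then have "cube_diff g a T w = 0"
          using assms(1) J(1) I(1) by (intro cube_diff_eq_0_of_degree) (auto intro: finite_subset)
        then show ?thesis
          unfolding c_def using \<open>finite J\<close> 2(1) by (intro cube_diff_zero_step[of J T])
      qed
    qed
  qed
  \<comment> \<open>\<open>J \<subseteq> Pow S\<close> is rewritten as \<open>\<Union>J \<subseteq> S\<close>, so that for fixed \<open>J\<close> the sets \<open>S\<close> form an interval.\<close>
  have "cube_diff (f \<circ> g) a I w
      = (\<Sum>S\<in>Pow I. \<Sum>J\<in>{J\<in>Pow (Pow I). \<Union>J \<subseteq> S}. signed (card S) (signed (card I) (c J)))"
    unfolding cube_diff_def
  proof (intro sum.cong refl)
    fix S assume S: "S \<in> Pow I"
    then have "card S \<le> card I" and "{J\<in>Pow (Pow I). \<Union>J \<subseteq> S} = Pow (Pow S)"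
      using I(1) by (auto intro: card_mono)
    then show "signed (card I - card S) ((f \<circ> g) (a + sum w S))
        = (\<Sum>J\<in>{J\<in>Pow (Pow I). \<Union>J \<subseteq> S}. signed (card S) (signed (card I) (c J)))"
      using expand[OF S] by (simp add: signed_diff signed_sum)
  qed
  also have "\<dots> = (\<Sum>J\<in>Pow (Pow I). \<Sum>S\<in>{S\<in>Pow I. \<Union>J \<subseteq> S}. signed (card S) (signed (card I) (c J)))"
    using I(1) by (intro sum.swap_restrict) auto
  also have "\<dots> = 0"
  proof (rule sum.neutral, rule ballI)
    fix J assume J: "J \<in> Pow (Pow I)"
    show "(\<Sum>S\<in>{S\<in>Pow I. \<Union>J \<subseteq> S}. signed (card S) (signed (card I) (c J))) = 0"
    proof (cases "\<Union>J = I")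
      case True
      then show ?thesis
        using J c_zero by simp
    next
      case False
      then have "\<Union>J \<subset> I"
        using J by auto
      with I(1) show ?thesis
        by (rule sum_signed_card_interval)
    qed
  qed
  finally show "iterated_diff (f \<circ> g) a (e * d + 1) w = 0"
    by (simp add: iterated_diff_eq_cube_diff I_def)
qed

end
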